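(* Let $L>0$ and let $\tilde\phi_0\in C^2([0,1])$ satisfy $\tilde\phi_0\ge0$, $\tilde\phi_0(0)=1$, $\tilde\phi_0'(0)=0$, $\tilde\phi_0(1)=\tilde\phi_0'(1)=0$ and $$c_0=\int_0^1\frac{|\tilde\phi_0''(\tau)|^2}{\tilde\phi_0(\tau)}\,d\tau<\infty .$$ Let $T>0$, let $\phi_0(t)=\tilde\phi_0(t/T)$, and let $u=u(x,t)$ be a sufficiently smooth solution of $$u_{tt}=\tfrac12 (u^2)_{xxx}\quad\text{for } x>0,\ 0<t<T,$$ satisfying the zero conditions $$u=0,\qquad (u^2)_x=0,\qquad (u^2)_{xx}=0\qquad\text{at } x=0 .$$ Set $J_0=\int_0^Lu_t(x,0)(L-x)^3\,dx$. Then $$\frac52\int_0^T\!\!\int_0^Lu^2\,\phi_0(t)\,dx\,dt\le\frac{c_0L^7}{7T^3}-J_0 .$$ Consequently, if $J_0>0$, the solution must blow up in a finite time $T_0$ satisfying $$T_0\le\Big(\frac{c_0L^7}{7J_0}\Big)^{1/3},$$ i.e. such a smooth solution cannot exist on $(0,T)$ for $T$ larger than this value.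
   Context: "Sufficiently smooth" means smooth enough on $[0,L]\times[0,T]$ that integration by parts three times in $x$ and twice in $t$ is justified. *)

theory Defs
  imports "HOL-Analysis.Analysis"
begin

text \<open>Points of the \<open>(x, t)\<close> plane are pairs. The partial derivatives are taken within the
  slices of the domain \<open>D\<close>, so they are one-sided at the edges of a closed rectangle and
  ordinary derivatives on an open set.\<close>

definition has_x_derivative_on ::
    "(real \<times> real \<Rightarrow> real) \<Rightarrow> (real \<times> real \<Rightarrow> real) \<Rightarrow> (real \<times> real) set \<Rightarrow> bool" where
  "has_x_derivative_on f g D \<longleftrightarrow>
    (\<forall>(x, t)\<in>D. ((\<lambda>y. f (y, t)) has_real_derivative g (x, t)) (at x within {y. (y, t) \<in> D}))"

definition has_t_derivative_on ::
    "(real \<times> real \<Rightarrow> real) \<Rightarrow> (real \<times> real \<Rightarrow> real) \<Rightarrow> (real \<times> real) set \<Rightarrow> bool" where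
  "has_t_derivative_on f g D \<longleftrightarrow>
    (\<forall>(x, t)\<in>D. ((\<lambda>s. f (x, s)) has_real_derivative g (x, t)) (at t within {s. (x, s) \<in> D}))"

text \<open>The functions \<open>u\<^sub>t\<close>, \<open>u\<^sub>t\<^sub>t\<close> are the time derivatives of \<open>u\<close>, and \<open>w\<^sub>1\<close>, \<open>w\<^sub>2\<close>, \<open>w\<^sub>3\<close> are the
  first three \<open>x\<close>-derivatives of \<open>u\<^sup>2\<close>. They exist on the domain \<open>x > 0\<close>, \<open>0 < t < T\<close> of the
  equation and, continuously, on the closed rectangle \<open>[0, L] \<times> [0, T]\<close>. This is what
  integrating by parts twice in \<open>t\<close> and three times in \<open>x\<close> uses; in particular only \<open>u\<^sup>2\<close>, not
  \<open>u\<close> itself, has to be differentiable in \<open>x\<close>.\<close>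

definition smooth_solution :: "real \<Rightarrow> real \<Rightarrow> (real \<times> real \<Rightarrow> real) \<Rightarrow> bool" where
  "smooth_solution L T u \<longleftrightarrow>
    (\<exists>u\<^sub>t u\<^sub>t\<^sub>t w\<^sub>1 w\<^sub>2 w\<^sub>3.
      (\<forall>D\<in>{{0..L} \<times> {0..T}, {0<..} \<times> {0<..<T}}.
        has_t_derivative_on u u\<^sub>t D \<and>
        has_t_derivative_on u\<^sub>t u\<^sub>t\<^sub>t D \<and>
        has_x_derivative_on (\<lambda>p. (u p)\<^sup>2) w\<^sub>1 D \<and>
        has_x_derivative_on w\<^sub>1 w\<^sub>2 D \<and>
        has_x_derivative_on w\<^sub>2 w\<^sub>3 D) \<and>
      (\<forall>f\<in>{u, u\<^sub>t, u\<^sub>t\<^sub>t, w\<^sub>1, w\<^sub>2, w\<^sub>3}. continuous_on ({0..L} \<times> {0..T}) f) \<and>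
      (\<forall>x>0. \<forall>t\<in>{0<..<T}. u\<^sub>t\<^sub>t (x, t) = 1 / 2 * w\<^sub>3 (x, t)) \<and>
      (\<forall>t\<in>{0<..<T}. u (0, t) = 0 \<and> w\<^sub>1 (0, t) = 0 \<and> w\<^sub>2 (0, t) = 0))"

text \<open>The one-sided derivative at \<open>t = 0\<close> does not refer to the time interval on which the
  solution exists.\<close>

definition J\<^sub>0 :: "real \<Rightarrow> (real \<times> real \<Rightarrow> real) \<Rightarrow> real" where
  "J\<^sub>0 L u =
    integral {0..L} (\<lambda>x. vector_derivative (\<lambda>t. u (x, t)) (at_right 0) * (L - x) ^ 3)"

text \<open>Division in \<^typ>\<open>ennreal\<close> gives \<open>a / 0 = \<infinity>\<close> for \<open>a > 0\<close> and \<open>0 / 0 = 0\<close>, so zeros of \<open>\<phi>\<close> at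
  which the second derivative does not vanish are not discarded by the convention \<open>a / 0 = 0\<close>
  of \<^typ>\<open>real\<close>.\<close>

definition c\<^sub>0 :: "(real \<Rightarrow> real) \<Rightarrow> (real \<Rightarrow> real) \<Rightarrow> ennreal" where
  "c\<^sub>0 \<phi> \<phi>'' = (\<integral>\<^sup>+\<tau>\<in>{0..1}. ennreal (\<bar>\<phi>'' \<tau>\<bar>\<^sup>2) / ennreal (\<phi> \<tau>) \<partial>lborel)"

end

theory Submission
  imports Defs
begin

text \<open>
  The proof tests the equation against \<open>(L - x)\<^sup>3 \<phi>(t / T)\<close>. Since \<open>(L - x)\<^sup>3\<close> vanishes to third
  order at \<open>x = L\<close> and \<open>u\<^sup>2\<close> has zero data up to second order at \<open>x = 0\<close>, three integrations by
  parts in \<open>x\<close> leave no boundary terms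
  (\<open>integral_third_derivative_weighted\<close>). Hence the moment
  \<open>F(t) = \<integral>\<^sub>0\<^sup>L u (L - x)\<^sup>3 dx\<close> and the energy \<open>W(t) = \<integral>\<^sub>0\<^sup>L u\<^sup>2 dx\<close> satisfy the ordinary differential
  equation \<open>F'' = 3 W\<close>, with \<open>F'(0) = J\<^sub>0\<close> (\<open>smooth_solution_moment\<close>).

  Two integrations by parts in \<open>t\<close> against \<open>\<phi>\<^sub>0(t) = \<phi>(t / T)\<close> then give
  \<open>3 \<integral> W \<phi>\<^sub>0 = \<integral> F \<phi>\<^sub>0'' - J\<^sub>0\<close>. In the first term on the right, Young's inequality
  \<open>u (L - x)\<^sup>3 \<phi>\<^sub>0'' \<le> u\<^sup>2 \<phi>\<^sub>0 / 2 + (L - x)\<^sup>6 (\<phi>\<^sub>0'')\<^sup>2 / (2 \<phi>\<^sub>0)\<close> produces half of \<open>\<integral> W \<phi>\<^sub>0\<close>,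
  which is absorbed on the left, plus a constant proportional to \<open>c\<^sub>0\<close>. This works because
  finiteness of \<open>c\<^sub>0\<close> forces \<open>\<phi>'' = 0\<close> almost everywhere on the zero set of \<open>\<phi>\<close>
  (\<open>c\<^sub>0_finite\<close>, \<open>integral_test_function_bound\<close>). The passage between \<open>\<phi>\<close> and \<open>\<phi>\<^sub>0\<close> is done
  by rescaling time, \<open>t = T s\<close>, so that the only test function needed is \<open>\<phi>\<close> on \<open>[0, 1]\<close>.

  As the left-hand side of the estimate is nonnegative, \<open>J\<^sub>0 > 0\<close> bounds every time of existence.
  Existence up to some time implies existence up to every earlier one, so the blow-up time is
  the supremum of the times of existence.
\<close>

section \<open>Integration by parts\<close>

lemma has_x_derivative_on_rectangleD:
  assumes "has_x_derivative_on f g (A \<times> B)" "x \<in> A" "t \<in> B"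
  shows "((\<lambda>y. f (y, t)) has_real_derivative g (x, t)) (at x within A)"
  using assms by (auto simp: has_x_derivative_on_def)

lemma has_t_derivative_on_rectangleD:
  assumes "has_t_derivative_on f g (A \<times> B)" "x \<in> A" "t \<in> B"
  shows "((\<lambda>s. f (x, s)) has_real_derivative g (x, t)) (at t within B)"
  using assms by (auto simp: has_t_derivative_on_def)

text \<open>The three integrations by parts are carried out at once by exhibiting the antiderivative of
  \<open>w3 (L - x)\<^sup>3 - 6 w\<close>. Each of its terms contains a factor that vanishes at \<open>x = L\<close> and one
  that vanishes at \<open>x = 0\<close>.\<close>

lemma integral_third_derivative_weighted:
  fixes w w1 w2 w3 :: "real \<Rightarrow> real"
  assumes "0 < L"
    and w: "\<And>x. x \<in> {0..L} \<Longrightarrow> (w has_real_derivative w1 x) (at x within {0..L})"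
    and w1: "\<And>x. x \<in> {0..L} \<Longrightarrow> (w1 has_real_derivative w2 x) (at x within {0..L})"
    and w2: "\<And>x. x \<in> {0..L} \<Longrightarrow> (w2 has_real_derivative w3 x) (at x within {0..L})"
    and zero: "w 0 = 0" "w1 0 = 0" "w2 0 = 0"
  shows "((\<lambda>x. w3 x * (L - x) ^ 3) has_integral 6 * integral {0..L} w) {0..L}"
proof -
  define H where "H x = (L - x) ^ 3 * w2 x + 3 * (L - x)\<^sup>2 * w1 x + 6 * (L - x) * w x" for x
  have "(H has_real_derivative w3 x * (L - x) ^ 3 - 6 * w x) (at x within {0..L})"
    if "x \<in> {0..L}" for x
    unfolding H_def
    by (rule derivative_eq_intros w[OF that] w1[OF that] w2[OF that] refl)+
       (simp add: algebra_simps power2_eq_square power3_eq_cube)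
  then have H: "((\<lambda>x. w3 x * (L - x) ^ 3 - 6 * w x) has_integral H L - H 0) {0..L}"
    using \<open>0 < L\<close> by (intro fundamental_theorem_of_calculus)
      (auto simp: has_real_derivative_iff_has_vector_derivative)
  have "H L - H 0 = 0"
    by (simp add: H_def zero)
  have cont_w: "continuous_on {0..L} w"
    by (rule DERIV_continuous_on) (fact w)
  have "((\<lambda>x. 6 * w x) has_integral 6 * integral {0..L} w) {0..L}"
    using cont_w
    by (intro has_integral_mult_right integrable_integral integrable_continuous_real)
  with H have "((\<lambda>x. (w3 x * (L - x) ^ 3 - 6 * w x) + 6 * w x) has_integral
      (H L - H 0) + 6 * integral {0..L} w) {0..L}"
    by (intro has_integral_add)
  then show ?thesis
    by (simp add: \<open>H L - H 0 = 0\<close>)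
qed

text \<open>Green's identity: \<open>G'' \<phi> - G \<phi>''\<close> is the derivative of \<open>G' \<phi> - G \<phi>'\<close>, and the boundary values of
  \<open>\<phi>\<close> leave only \<open>G' 0\<close>.\<close>

lemma integral_second_derivative_test_function:
  fixes G G' G'' \<phi> \<phi>' \<phi>'' :: "real \<Rightarrow> real"
  assumes G: "\<And>s. s \<in> {0..1} \<Longrightarrow> (G has_real_derivative G' s) (at s within {0..1})"
    and G': "\<And>s. s \<in> {0..1} \<Longrightarrow> (G' has_real_derivative G'' s) (at s within {0..1})"
    and \<phi>: "\<And>s. s \<in> {0..1} \<Longrightarrow> (\<phi> has_real_derivative \<phi>' s) (at s within {0..1})"
    and \<phi>': "\<And>s. s \<in> {0..1} \<Longrightarrow> (\<phi>' has_real_derivative \<phi>'' s) (at s within {0..1})"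
    and "continuous_on {0..1} \<phi>''"
    and "\<phi> 0 = 1" "\<phi>' 0 = 0" "\<phi> 1 = 0" "\<phi>' 1 = 0"
  shows "((\<lambda>s. G'' s * \<phi> s) has_integral integral {0..1} (\<lambda>s. G s * \<phi>'' s) - G' 0) {0..1}"
proof -
  have "((\<lambda>s. G' s * \<phi> s - G s * \<phi>' s) has_real_derivative G'' s * \<phi> s - G s * \<phi>'' s)
      (at s within {0..1})" if "s \<in> {0..1}" for s
    by (rule derivative_eq_intros G[OF that] G'[OF that] \<phi>[OF that] \<phi>'[OF that] refl)+ simp
  then have green: "((\<lambda>s. G'' s * \<phi> s - G s * \<phi>'' s) has_integral
      (G' 1 * \<phi> 1 - G 1 * \<phi>' 1) - (G' 0 * \<phi> 0 - G 0 * \<phi>' 0)) {0..1}"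
    by (intro fundamental_theorem_of_calculus)
      (auto simp: has_real_derivative_iff_has_vector_derivative)
  have cont_G: "continuous_on {0..1} G"
    by (rule DERIV_continuous_on) (fact G)
  have "((\<lambda>s. G s * \<phi>'' s) has_integral integral {0..1} (\<lambda>s. G s * \<phi>'' s)) {0..1}"
    using cont_G assms(5)
    by (intro integrable_integral integrable_continuous_real continuous_on_mult)
  from has_integral_add[OF green this] show ?thesis
    by (simp add: assms(6-))
qed

section \<open>Absorbing the test function\<close>

text \<open>The convention \<open>a / 0 = \<infinity>\<close> for \<open>a > 0\<close> makes the integrand of \<open>c\<^sub>0\<close> infinite wherever
  \<open>\<phi> = 0 \<noteq> \<phi>''\<close>, so a finite integral makes this set null. Off that set the extended quotient
  agrees with the real one, which turns \<open>c\<^sub>0\<close> into an ordinary integral.\<close>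

lemma c\<^sub>0_finite:
  assumes \<phi>: "continuous_on {0..1} \<phi>" and \<phi>'': "continuous_on {0..1} \<phi>''"
    and nonneg: "\<And>s. s \<in> {0..1} \<Longrightarrow> 0 \<le> \<phi> s"
    and fin: "c\<^sub>0 \<phi> \<phi>'' < \<infinity>"
  shows "negligible {s \<in> {0..1}. \<phi> s = 0 \<and> \<phi>'' s \<noteq> 0}"
    and "((\<lambda>s. (\<phi>'' s)\<^sup>2 / \<phi> s) has_integral enn2real (c\<^sub>0 \<phi> \<phi>'')) {0..1}"
proof -
  define a where "a s = indicator {0..1} s *\<^sub>R \<phi> s" for s
  define b where "b s = indicator {0..1} s *\<^sub>R \<phi>'' s" for s
  define h where "h s = ennreal ((b s)\<^sup>2) / ennreal (a s)" for s
  have [measurable]: "a \<in> borel_measurable borel" "b \<in> borel_measurable borel"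
    unfolding a_def[abs_def] b_def[abs_def]
    by (intro borel_measurable_continuous_on_indicator \<phi> \<phi>''; simp)+
  have [measurable]: "h \<in> borel_measurable lborel"
    unfolding h_def by measurable
  have a_nonneg: "0 \<le> a s" for s
    using nonneg by (auto simp: a_def indicator_def)
  have c: "c\<^sub>0 \<phi> \<phi>'' = (\<integral>\<^sup>+s. h s \<partial>lborel)"
    unfolding c\<^sub>0_def by (intro nn_integral_cong) (auto simp: h_def a_def b_def indicator_def)
  have "AE s in lborel. h s \<noteq> \<infinity>"
    using fin by (intro nn_integral_PInf_AE) (auto simp: c)
  then have ae: "AE s in lborel. a s = 0 \<longrightarrow> b s = 0"
    by eventually_elim (auto simp: h_def ennreal_divide_eq_top_iff)
  then obtain N where N: "{s. \<not> (a s = 0 \<longrightarrow> b s = 0)} \<subseteq> N" "N \<in> null_sets lborel"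
    by (auto simp: eventually_ae_filter)
  then have "negligible N"
    by (simp add: negligible_iff_null_sets null_sets_completionI)
  then show "negligible {s \<in> {0..1}. \<phi> s = 0 \<and> \<phi>'' s \<noteq> 0}"
    by (rule negligible_subset) (use N(1) in \<open>auto simp: a_def b_def\<close>)
  have "(\<integral>\<^sup>+s. ennreal ((b s)\<^sup>2 / a s) \<partial>lborel) = (\<integral>\<^sup>+s. h s \<partial>lborel)"
  proof (rule nn_integral_cong_AE)
    show "AE s in lborel. ennreal ((b s)\<^sup>2 / a s) = h s"
      using ae
    proof eventually_elim
      case (elim s)
      then show ?case
        using a_nonneg[of s] by (cases "a s = 0") (auto simp: h_def divide_ennreal)
    qed
  qed
  also have "\<dots> = ennreal (enn2real (c\<^sub>0 \<phi> \<phi>''))"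
    using fin by (simp add: c)
  finally have "((\<lambda>s. (b s)\<^sup>2 / a s) has_integral enn2real (c\<^sub>0 \<phi> \<phi>'')) UNIV"
    using a_nonneg by (intro nn_integral_has_integral) auto
  also have "(\<lambda>s. (b s)\<^sup>2 / a s) = (\<lambda>s. if s \<in> {0..1} then (\<phi>'' s)\<^sup>2 / \<phi> s else 0)"
    by (auto simp: a_def b_def indicator_def)
  finally show "((\<lambda>s. (\<phi>'' s)\<^sup>2 / \<phi> s) has_integral enn2real (c\<^sub>0 \<phi> \<phi>'')) {0..1}"
    by (simp only: has_integral_restrict_UNIV)
qed

text \<open>The hypothesis on \<open>F\<close> and \<open>W\<close> is Young's inequality with a free parameter \<open>p\<close>; it is a way of
  saying \<open>F\<^sup>2 \<le> A W\<close>. The parameter is chosen pointwise as \<open>p = k \<phi>(s)\<close>, which is admissible where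
  \<open>\<phi> > 0\<close>; the points with \<open>\<phi> = 0\<close> contribute nothing up to a null set.\<close>

lemma integral_test_function_bound:
  assumes \<phi>: "continuous_on {0..1} \<phi>" and \<phi>'': "continuous_on {0..1} \<phi>''"
    and nonneg: "\<And>s. s \<in> {0..1} \<Longrightarrow> 0 \<le> \<phi> s"
    and fin: "c\<^sub>0 \<phi> \<phi>'' < \<infinity>"
    and F: "continuous_on {0..1} F" and W: "continuous_on {0..1} W"
    and A: "\<And>s a p. \<lbrakk>s \<in> {0..1}; 0 < p\<rbrakk> \<Longrightarrow> F s * a \<le> p / 2 * W s + A / (2 * p) * a\<^sup>2"
    and "0 < k"
  shows "integral {0..1} (\<lambda>s. F s * \<phi>'' s)
    \<le> k / 2 * integral {0..1} (\<lambda>s. W s * \<phi> s) + A / (2 * k) * enn2real (c\<^sub>0 \<phi> \<phi>'')"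
proof -
  define N where "N = {s \<in> {0..1}. \<phi> s = 0 \<and> \<phi>'' s \<noteq> 0}"
  have "negligible N"
    unfolding N_def by (rule c\<^sub>0_finite(1)[OF \<phi> \<phi>'' nonneg fin])
  \<comment> \<open>The dominating function is altered on the null set so that the comparison holds at every point.\<close>
  define R where "R s = (if s \<in> N then F s * \<phi>'' s
    else k / 2 * (W s * \<phi> s) + A / (2 * k) * ((\<phi>'' s)\<^sup>2 / \<phi> s))" for s
  have "((\<lambda>s. k / 2 * (W s * \<phi> s) + A / (2 * k) * ((\<phi>'' s)\<^sup>2 / \<phi> s)) has_integral
      k / 2 * integral {0..1} (\<lambda>s. W s * \<phi> s) + A / (2 * k) * enn2real (c\<^sub>0 \<phi> \<phi>'')) {0..1}"
    by (intro has_integral_add has_integral_mult_right integrable_integral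
        integrable_continuous_real continuous_on_mult W \<phi> c\<^sub>0_finite(2) \<phi>'' nonneg fin)
  then have R: "(R has_integral
      k / 2 * integral {0..1} (\<lambda>s. W s * \<phi> s) + A / (2 * k) * enn2real (c\<^sub>0 \<phi> \<phi>'')) {0..1}"
    by (rule has_integral_spike[OF \<open>negligible N\<close>, rotated]) (auto simp: R_def)
  have "F s * \<phi>'' s \<le> R s" if s: "s \<in> {0..1}" for s
  proof (cases "\<phi> s = 0")
    case True
    then show ?thesis
      using s by (cases "\<phi>'' s = 0") (auto simp: R_def N_def)
  next
    case False
    then have "0 < \<phi> s"
      using nonneg[OF s] by simp
    then have "F s * \<phi>'' s \<le> k * \<phi> s / 2 * W s + A / (2 * (k * \<phi> s)) * (\<phi>'' s)\<^sup>2"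
      using \<open>0 < k\<close> by (intro A s) simp
    then show ?thesis
      using False by (simp add: R_def N_def mult_ac)
  qed
  moreover have "(\<lambda>s. F s * \<phi>'' s) integrable_on {0..1}"
    by (intro integrable_continuous_real continuous_on_mult F \<phi>'')
  ultimately show ?thesis
    using has_integral_le[OF integrable_integral R] by blast
qed

text \<open>The constant \<open>L\<^sup>7 / 7\<close> is \<open>\<integral>\<^sub>0\<^sup>L (L - x)\<^sup>6 dx\<close>, the squared norm of the weight.\<close>

lemma integral_weight_young:
  fixes L a p :: real and v :: "real \<Rightarrow> real"
  assumes "0 < L" and v: "continuous_on {0..L} v" and "0 < p"
  shows "integral {0..L} (\<lambda>x. v x * (L - x) ^ 3) * a
    \<le> p / 2 * integral {0..L} (\<lambda>x. (v x)\<^sup>2) + (L ^ 7 / 7) / (2 * p) * a\<^sup>2"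
proof -
  have "((\<lambda>x. (L - x) ^ 6) has_integral (- ((L - L) ^ 7 / 7)) - (- ((L - 0) ^ 7 / 7))) {0..L}"
    using \<open>0 < L\<close>
    by (intro fundamental_theorem_of_calculus)
       (auto simp flip: has_real_derivative_iff_has_vector_derivative
             intro!: derivative_eq_intros)
  then have pow: "((\<lambda>x. (L - x) ^ 6) has_integral L ^ 7 / 7) {0..L}"
    by simp
  have "v x * (L - x) ^ 3 * a \<le> p / 2 * (v x)\<^sup>2 + a\<^sup>2 / (2 * p) * (L - x) ^ 6" for x
  proof -
    define q where "q = (L - x) ^ 3 * a"
    have "0 \<le> (p * v x - q)\<^sup>2 / (2 * p)"
      using \<open>0 < p\<close> by simp
    also have "\<dots> = p / 2 * (v x)\<^sup>2 + q\<^sup>2 / (2 * p) - v x * q"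
      using \<open>0 < p\<close> by (simp add: field_simps power2_eq_square)
    also have "q\<^sup>2 = a\<^sup>2 * (L - x) ^ 6"
      by (simp add: q_def power_mult_distrib flip: power_mult)
    finally show ?thesis
      by (simp add: q_def algebra_simps)
  qed
  moreover have "((\<lambda>x. p / 2 * (v x)\<^sup>2 + a\<^sup>2 / (2 * p) * (L - x) ^ 6) has_integral
      p / 2 * integral {0..L} (\<lambda>x. (v x)\<^sup>2) + a\<^sup>2 / (2 * p) * (L ^ 7 / 7)) {0..L}"
  proof -
    have "(\<lambda>x. (v x)\<^sup>2) integrable_on {0..L}"
      by (intro integrable_continuous_real continuous_intros v)
    then show ?thesis
      by (intro has_integral_add has_integral_mult_right pow integrable_integral)
  qed
  moreover have "((\<lambda>x. v x * (L - x) ^ 3 * a) has_integral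
      integral {0..L} (\<lambda>x. v x * (L - x) ^ 3) * a) {0..L}"
  proof -
    have "(\<lambda>x. v x * (L - x) ^ 3) integrable_on {0..L}"
      by (intro integrable_continuous_real continuous_intros v)
    then show ?thesis
      by (rule has_integral_mult_left[OF integrable_integral])
  qed
  ultimately have "integral {0..L} (\<lambda>x. v x * (L - x) ^ 3) * a
      \<le> p / 2 * integral {0..L} (\<lambda>x. (v x)\<^sup>2) + a\<^sup>2 / (2 * p) * (L ^ 7 / 7)"
    by (meson has_integral_le)
  then show ?thesis
    by (simp add: mult_ac)
qed

section \<open>Smooth solutions\<close>

lemma smooth_solution_mono:
  assumes "smooth_solution L T u" "S \<le> T"
  shows "smooth_solution L S u"
proof -
  have x: "has_x_derivative_on f g D'" if "has_x_derivative_on f g D" "D' \<subseteq> D" for f g D D'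
    unfolding has_x_derivative_on_def
  proof clarify
    fix x t
    assume "(x, t) \<in> D'"
    then have "((\<lambda>y. f (y, t)) has_real_derivative g (x, t)) (at x within {y. (y, t) \<in> D})"
      using that unfolding has_x_derivative_on_def by blast
    then show "((\<lambda>y. f (y, t)) has_real_derivative g (x, t)) (at x within {y. (y, t) \<in> D'})"
      by (rule has_field_derivative_subset) (use \<open>D' \<subseteq> D\<close> in auto)
  qed
  have t: "has_t_derivative_on f g D'" if "has_t_derivative_on f g D" "D' \<subseteq> D" for f g D D'
    unfolding has_t_derivative_on_def
  proof clarify
    fix x t
    assume "(x, t) \<in> D'"
    then have "((\<lambda>s. f (x, s)) has_real_derivative g (x, t)) (at t within {s. (x, s) \<in> D})"
      using that unfolding has_t_derivative_on_def by blast
    then show "((\<lambda>s. f (x, s)) has_real_derivative g (x, t)) (at t within {s. (x, s) \<in> D'})"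
      by (rule has_field_derivative_subset) (use \<open>D' \<subseteq> D\<close> in auto)
  qed
  have sub: "{0..L} \<times> {0..S} \<subseteq> {0..L} \<times> {0..T}" "{0<..} \<times> {0<..<S} \<subseteq> {0<..} \<times> {0<..<T}"
    using \<open>S \<le> T\<close> by auto
  from assms(1) obtain u1 u2 w1 w2 w3 where
    D: "\<forall>D\<in>{{0..L} \<times> {0..T}, {0<..} \<times> {0<..<T}}.
        has_t_derivative_on u u1 D \<and> has_t_derivative_on u1 u2 D \<and>
        has_x_derivative_on (\<lambda>p. (u p)\<^sup>2) w1 D \<and>
        has_x_derivative_on w1 w2 D \<and> has_x_derivative_on w2 w3 D"
    and C: "\<forall>f\<in>{u, u1, u2, w1, w2, w3}. continuous_on ({0..L} \<times> {0..T}) f"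
    and E: "\<forall>x>0. \<forall>t\<in>{0<..<T}. u2 (x, t) = 1 / 2 * w3 (x, t)"
    and Z: "\<forall>t\<in>{0<..<T}. u (0, t) = 0 \<and> w1 (0, t) = 0 \<and> w2 (0, t) = 0"
    unfolding smooth_solution_def by blast
  show ?thesis
    unfolding smooth_solution_def
  proof (rule exI[of _ u1], rule exI[of _ u2], rule exI[of _ w1], rule exI[of _ w2],
      rule exI[of _ w3], intro conjI)
    show "\<forall>D\<in>{{0..L} \<times> {0..S}, {0<..} \<times> {0<..<S}}.
        has_t_derivative_on u u1 D \<and> has_t_derivative_on u1 u2 D \<and>
        has_x_derivative_on (\<lambda>p. (u p)\<^sup>2) w1 D \<and>
        has_x_derivative_on w1 w2 D \<and> has_x_derivative_on w2 w3 D"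
      using D x[OF _ sub(1)] x[OF _ sub(2)] t[OF _ sub(1)] t[OF _ sub(2)] by simp
    show "\<forall>f\<in>{u, u1, u2, w1, w2, w3}. continuous_on ({0..L} \<times> {0..S}) f"
      using C continuous_on_subset[OF _ sub(1)] by blast
  qed (use E Z \<open>S \<le> T\<close> in auto)
qed

text \<open>The equation holds only for \<open>0 < t < T\<close>, hence the open interval in the identity
  \<open>F'' = 3 W\<close>.\<close>

lemma smooth_solution_moment:
  fixes u :: "real \<times> real \<Rightarrow> real"
  assumes "0 < L" "0 < T" "smooth_solution L T u"
  defines "F \<equiv> \<lambda>t. integral {0..L} (\<lambda>x. u (x, t) * (L - x) ^ 3)"
    and "W \<equiv> \<lambda>t. integral {0..L} (\<lambda>x. (u (x, t))\<^sup>2)"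
  obtains F' F'' where
    "\<And>t. t \<in> {0..T} \<Longrightarrow> (F has_real_derivative F' t) (at t within {0..T})"
    "\<And>t. t \<in> {0..T} \<Longrightarrow> (F' has_real_derivative F'' t) (at t within {0..T})"
    "\<And>t. t \<in> {0<..<T} \<Longrightarrow> F'' t = 3 * W t"
    "F' 0 = J\<^sub>0 L u"
proof -
  let ?R = "{0..L} \<times> {0..T}"
  from assms(3) obtain u1 u2 w1 w2 w3 where
    ut: "has_t_derivative_on u u1 ?R" "has_t_derivative_on u1 u2 ?R"
    and wx: "has_x_derivative_on (\<lambda>p. (u p)\<^sup>2) w1 ?R" "has_x_derivative_on w1 w2 ?R"
      "has_x_derivative_on w2 w3 ?R"
    and C: "continuous_on ?R u" "continuous_on ?R u1" "continuous_on ?R u2"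
    and E: "\<And>x t. \<lbrakk>0 < x; t \<in> {0<..<T}\<rbrakk> \<Longrightarrow> u2 (x, t) = 1 / 2 * w3 (x, t)"
    and Z: "\<And>t. t \<in> {0<..<T} \<Longrightarrow> u (0, t) = 0 \<and> w1 (0, t) = 0 \<and> w2 (0, t) = 0"
    unfolding smooth_solution_def by (smt (verit) insert_iff)
  define M where "M v t = integral {0..L} (\<lambda>x. v (x, t) * (L - x) ^ 3)"
    for v :: "real \<times> real \<Rightarrow> real" and t
  have M: "(M v has_real_derivative M v' t) (at t within {0..T})"
    if d: "has_t_derivative_on v v' ?R" and v: "continuous_on ?R v" and v': "continuous_on ?R v'"
      and t: "t \<in> {0..T}" for v v' t
  proof -
    have "((\<lambda>t. integral (cbox 0 L) (\<lambda>x. v (x, t) * (L - x) ^ 3)) has_real_derivative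
        integral (cbox 0 L) (\<lambda>x. v' (x, t) * (L - x) ^ 3)) (at t within {0..T})"
    proof (rule leibniz_rule_field_derivative)
      show "((\<lambda>t. v (x, t) * (L - x) ^ 3) has_real_derivative v' (x, s) * (L - x) ^ 3)
          (at s within {0..T})" if "s \<in> {0..T}" "x \<in> cbox 0 L" for s x
        using has_t_derivative_on_rectangleD[OF d] that by (intro DERIV_cmult_right) auto
      show "(\<lambda>x. v (x, s) * (L - x) ^ 3) integrable_on cbox 0 L" if "s \<in> {0..T}" for s
        using that by (intro integrable_continuous continuous_intros continuous_on_compose2[OF v])
          auto
      show "continuous_on ({0..T} \<times> cbox 0 L) (\<lambda>(s, x). v' (x, s) * (L - x) ^ 3)"
        unfolding case_prod_unfold
        by (intro continuous_intros continuous_on_compose2[OF v']) auto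
    qed (use t in auto)
    then show ?thesis
      by (simp add: M_def[abs_def])
  qed
  show thesis
  proof (rule that)
    show "(F has_real_derivative M u1 t) (at t within {0..T})" if "t \<in> {0..T}" for t
      using M[OF ut(1) C(1,2) that] by (simp add: F_def M_def[abs_def])
    show "(M u1 has_real_derivative M u2 t) (at t within {0..T})" if "t \<in> {0..T}" for t
      using M[OF ut(2) C(2,3) that] .
    show "M u2 t = 3 * W t" if t: "t \<in> {0<..<T}" for t
    proof -
      have "((\<lambda>x. w3 (x, t) * (L - x) ^ 3) has_integral 6 * W t) {0..L}"
        unfolding W_def
        by (rule integral_third_derivative_weighted[where ?w1.0 = "\<lambda>x. w1 (x, t)"
              and ?w2.0 = "\<lambda>x. w2 (x, t)"])
           (use wx[THEN has_x_derivative_on_rectangleD] t Z[OF t] \<open>0 < L\<close> in auto)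
      then have "((\<lambda>x. 1 / 2 * (w3 (x, t) * (L - x) ^ 3)) has_integral 1 / 2 * (6 * W t)) {0..L}"
        by (rule has_integral_mult_right)
      \<comment> \<open>At \<open>x = 0\<close> the equation is not assumed, but a single point does not affect the integral.\<close>
      then have "((\<lambda>x. u2 (x, t) * (L - x) ^ 3) has_integral 1 / 2 * (6 * W t)) {0..L}"
        by (rule has_integral_spike_finite[where S = "{0}", rotated 2]) (use t in \<open>auto simp: E\<close>)
      then show ?thesis
        by (simp add: M_def integral_unique)
    qed
    have "vector_derivative (\<lambda>t. u (x, t)) (at_right 0) = u1 (x, 0)" if "x \<in> {0..L}" for x
    proof -
      have "((\<lambda>t. u (x, t)) has_real_derivative u1 (x, 0)) (at 0 within {0..T})"
        using has_t_derivative_on_rectangleD[OF ut(1)] that \<open>0 < T\<close> by simp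
      then have "((\<lambda>t. u (x, t)) has_vector_derivative u1 (x, 0)) (at_right 0)"
        using at_within_Icc_at_right[OF \<open>0 < T\<close>]
        by (simp add: has_real_derivative_iff_has_vector_derivative)
      then show ?thesis
        by (rule vector_derivative_within[rotated]) simp
    qed
    then show "M u1 0 = J\<^sub>0 L u"
      unfolding M_def J\<^sub>0_def by (intro integral_cong) simp
  qed
qed

text \<open>With \<open>t = T s\<close> the identity reads
  \<open>3 T\<^sup>2 \<integral> W(T s) \<phi>(s) ds = \<integral> F(T s) \<phi>''(s) ds - T J\<^sub>0\<close>. Young's inequality with \<open>k = T\<^sup>2\<close> takes
  \<open>T\<^sup>2 / 2\<close> of the energy term from the left, leaving the factor \<open>5 / 2\<close>, and its other half
  accounts for \<open>14 = 2 \<cdot> 7\<close>.\<close>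

lemma smooth_solution_estimate:
  fixes u :: "real \<times> real \<Rightarrow> real"
  assumes "0 < L"
    and \<phi>: "\<And>s. s \<in> {0..1} \<Longrightarrow> (\<phi> has_real_derivative \<phi>' s) (at s within {0..1})"
    and \<phi>': "\<And>s. s \<in> {0..1} \<Longrightarrow> (\<phi>' has_real_derivative \<phi>'' s) (at s within {0..1})"
    and \<phi>'': "continuous_on {0..1} \<phi>''"
    and nonneg: "\<And>s. s \<in> {0..1} \<Longrightarrow> 0 \<le> \<phi> s"
    and bc: "\<phi> 0 = 1" "\<phi>' 0 = 0" "\<phi> 1 = 0" "\<phi>' 1 = 0"
    and fin: "c\<^sub>0 \<phi> \<phi>'' < \<infinity>"
    and "0 < T" and u: "smooth_solution L T u"
  shows "5 / 2 * integral {0..T} (\<lambda>t. integral {0..L} (\<lambda>x. (u (x, t))\<^sup>2 * \<phi> (t / T)))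
    \<le> enn2real (c\<^sub>0 \<phi> \<phi>'') * L ^ 7 / (14 * T ^ 3) - J\<^sub>0 L u"
proof -
  let ?c = "enn2real (c\<^sub>0 \<phi> \<phi>'')"
  define F where "F = (\<lambda>t. integral {0..L} (\<lambda>x. u (x, t) * (L - x) ^ 3))"
  define W where "W t = integral {0..L} (\<lambda>x. (u (x, t))\<^sup>2)" for t
  define I where "I = integral {0..1} (\<lambda>s. W (T * s) * \<phi> s)"
  obtain F' F'' where
    F: "\<And>t. t \<in> {0..T} \<Longrightarrow> (F has_real_derivative F' t) (at t within {0..T})"
    and F': "\<And>t. t \<in> {0..T} \<Longrightarrow> (F' has_real_derivative F'' t) (at t within {0..T})"
    and F'': "\<And>t. t \<in> {0<..<T} \<Longrightarrow> F'' t = 3 * W t"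
    and J: "F' 0 = J\<^sub>0 L u"
    using smooth_solution_moment[OF \<open>0 < L\<close> \<open>0 < T\<close> u, folded F_def W_def] by blast
  have cont: "continuous_on ({0..L} \<times> {0..T}) u"
    using u unfolding smooth_solution_def by blast
  have slice: "continuous_on {0..L} (\<lambda>x. u (x, t))" if "t \<in> {0..T}" for t
    using that by (intro continuous_on_compose2[OF cont] continuous_intros) auto
  have "continuous_on {0..T} (\<lambda>t. integral (cbox 0 L) (\<lambda>x. (u (x, t))\<^sup>2))"
    by (intro integral_continuous_on_param)
       (auto simp: case_prod_unfold intro!: continuous_intros continuous_on_compose2[OF cont])
  then have W: "continuous_on {0..T} W"
    by (simp add: W_def[abs_def])
  have contF: "continuous_on {0..T} F"
    by (rule DERIV_continuous_on) (fact F)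
  have cont\<phi>: "continuous_on {0..1} \<phi>"
    by (rule DERIV_continuous_on) (fact \<phi>)
  have scale: "T * s \<in> {0..T}" if "s \<in> {0..1}" for s
    using that \<open>0 < T\<close> by auto
  have chain: "((\<lambda>s. f (T * s)) has_real_derivative T * f' (T * s)) (at s within {0..1})"
    if f: "\<And>t. t \<in> {0..T} \<Longrightarrow> (f has_real_derivative f' t) (at t within {0..T})"
      and s: "s \<in> {0..1}" for f f' s
  proof -
    have "((\<lambda>s. T * s) has_real_derivative T) (at s within {0..1})"
      by (auto intro!: derivative_eq_intros)
    moreover have "(f has_real_derivative f' (T * s)) (at (T * s) within (\<lambda>s. T * s) ` {0..1})"
      by (rule has_field_derivative_subset[OF f]) (use scale s in auto)
    ultimately show ?thesis
      using DERIV_image_chain[of f "f' (T * s)" "\<lambda>s. T * s"] by (simp add: o_def mult.commute)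
  qed
  have "((\<lambda>s. T * (T * F'' (T * s)) * \<phi> s) has_integral
      integral {0..1} (\<lambda>s. F (T * s) * \<phi>'' s) - T * F' (T * 0)) {0..1}"
  proof (rule integral_second_derivative_test_function[where G' = "\<lambda>s. T * F' (T * s)"
        and \<phi>' = \<phi>'])
    show "((\<lambda>s. F (T * s)) has_real_derivative T * F' (T * s)) (at s within {0..1})"
      if "s \<in> {0..1}" for s
      using chain[OF F that] .
    show "((\<lambda>s. T * F' (T * s)) has_real_derivative T * (T * F'' (T * s))) (at s within {0..1})"
      if "s \<in> {0..1}" for s
      using DERIV_cmult[OF chain[OF F' that]] .
  qed (use \<phi> \<phi>' \<phi>'' bc in auto)
  \<comment> \<open>The endpoints, at which \<open>F'' = 3 W\<close> is not known, form a finite set.\<close>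
  then have "((\<lambda>s. 3 * T\<^sup>2 * (W (T * s) * \<phi> s)) has_integral
      integral {0..1} (\<lambda>s. F (T * s) * \<phi>'' s) - T * F' (T * 0)) {0..1}"
    by (rule has_integral_spike_finite[where S = "{0, 1}", rotated 2])
       (use \<open>0 < T\<close> in \<open>auto simp: F'' power2_eq_square\<close>)
  then have parts: "3 * T\<^sup>2 * I = integral {0..1} (\<lambda>s. F (T * s) * \<phi>'' s) - T * J\<^sub>0 L u"
    by (simp add: I_def J integral_unique flip: integral_mult_right)
  have "integral {0..1} (\<lambda>s. F (T * s) * \<phi>'' s) \<le> T\<^sup>2 / 2 * I + (L ^ 7 / 7) / (2 * T\<^sup>2) * ?c"
    unfolding I_def
  proof (rule integral_test_function_bound[OF cont\<phi> \<phi>'' nonneg fin])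
    show "continuous_on {0..1} (\<lambda>s. F (T * s))" "continuous_on {0..1} (\<lambda>s. W (T * s))"
      using scale by (auto intro!: continuous_on_compose2[OF contF] continuous_on_compose2[OF W]
          continuous_intros)
    show "F (T * s) * a \<le> p / 2 * W (T * s) + (L ^ 7 / 7) / (2 * p) * a\<^sup>2"
      if "s \<in> {0..1}" "0 < p" for s a p
      unfolding F_def W_def
      using integral_weight_young[OF \<open>0 < L\<close> slice[OF scale[OF that(1)]] that(2)] .
  qed (use \<open>0 < T\<close> in auto)
  with parts have "5 / 2 * T\<^sup>2 * I \<le> (L ^ 7 / 7) / (2 * T\<^sup>2) * ?c - T * J\<^sub>0 L u"
    by (simp only: algebra_simps)
  then have "(5 / 2 * T\<^sup>2 * I) / T \<le> ((L ^ 7 / 7) / (2 * T\<^sup>2) * ?c - T * J\<^sub>0 L u) / T"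
    using \<open>0 < T\<close> by (intro divide_right_mono) auto
  then have main: "5 / 2 * (T * I) \<le> ?c * L ^ 7 / (14 * T ^ 3) - J\<^sub>0 L u"
    using \<open>0 < T\<close> by (simp add: diff_divide_distrib power2_eq_square power3_eq_cube mult_ac)
  have "((\<lambda>s. W (T * s) * \<phi> s) has_integral I) {0..1}"
    unfolding I_def using scale
    by (intro integrable_integral integrable_continuous_real continuous_on_mult
        continuous_on_compose2[OF W] continuous_intros cont\<phi>) auto
  from has_integral_stretch_real[OF this, of "1 / T"]
  have "((\<lambda>t. W t * \<phi> (t / T)) has_integral T * I) ((\<lambda>t. t * T) ` {0..1})"
    using \<open>0 < T\<close> by simp
  also have "(\<lambda>t. t * T) ` {0..1} = {0..T}"
    using \<open>0 < T\<close> by (simp add: image_mult_atLeastAtMost_if')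
  finally have "integral {0..T} (\<lambda>t. integral {0..L} (\<lambda>x. (u (x, t))\<^sup>2 * \<phi> (t / T))) = T * I"
    by (simp add: W_def integral_unique)
  with main show ?thesis
    by simp
qed

section \<open>Blow-up\<close>

theorem mainTheorem5:
  fixes L :: real and \<phi> \<phi>' \<phi>'' :: "real \<Rightarrow> real"
  assumes "0 < L"
    and "\<forall>\<tau>\<in>{0..1}. (\<phi> has_real_derivative \<phi>' \<tau>) (at \<tau> within {0..1})"
    and "\<forall>\<tau>\<in>{0..1}. (\<phi>' has_real_derivative \<phi>'' \<tau>) (at \<tau> within {0..1})"
    and "continuous_on {0..1} \<phi>''"
    and "\<forall>\<tau>\<in>{0..1}. 0 \<le> \<phi> \<tau>"
    and "\<phi> 0 = 1" and "\<phi>' 0 = 0" and "\<phi> 1 = 0" and "\<phi>' 1 = 0"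
    and "c\<^sub>0 \<phi> \<phi>'' < \<infinity>"
  shows
    "(\<forall>T u. 0 < T \<and> smooth_solution L T u \<longrightarrow>
        5 / 2 * integral {0..T} (\<lambda>t. integral {0..L} (\<lambda>x. (u (x, t))\<^sup>2 * \<phi> (t / T)))
          \<le> enn2real (c\<^sub>0 \<phi> \<phi>'') * L ^ 7 / (7 * T ^ 3) - J\<^sub>0 L u)
     \<and> (\<forall>u. 0 < J\<^sub>0 L u \<and> (\<exists>T>0. smooth_solution L T u) \<longrightarrow>
        (\<exists>T\<^sub>0>0. T\<^sub>0 \<le> root 3 (enn2real (c\<^sub>0 \<phi> \<phi>'') * L ^ 7 / (7 * J\<^sub>0 L u)) \<and>
          (\<forall>T. 0 < T \<and> T < T\<^sub>0 \<longrightarrow> smooth_solution L T u) \<and>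
          (\<forall>T>T\<^sub>0. \<not> smooth_solution L T u)))
     \<and> (\<forall>T u. 0 < J\<^sub>0 L u \<and> root 3 (enn2real (c\<^sub>0 \<phi> \<phi>'') * L ^ 7 / (7 * J\<^sub>0 L u)) < T \<longrightarrow>
        \<not> smooth_solution L T u)"
proof -
  let ?c = "enn2real (c\<^sub>0 \<phi> \<phi>'')"
  have estimate: "5 / 2 * integral {0..T} (\<lambda>t. integral {0..L} (\<lambda>x. (u (x, t))\<^sup>2 * \<phi> (t / T)))
      \<le> ?c * L ^ 7 / (7 * T ^ 3) - J\<^sub>0 L u" if "0 < T" "smooth_solution L T u" for T u
  proof -
    have "?c * L ^ 7 / (14 * T ^ 3) \<le> ?c * L ^ 7 / (7 * T ^ 3)"
      using that(1) \<open>0 < L\<close> by (intro divide_left_mono) auto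
    moreover have "5 / 2 * integral {0..T} (\<lambda>t. integral {0..L} (\<lambda>x. (u (x, t))\<^sup>2 * \<phi> (t / T)))
        \<le> ?c * L ^ 7 / (14 * T ^ 3) - J\<^sub>0 L u"
      by (rule smooth_solution_estimate[of L \<phi> \<phi>' \<phi>'']) (use assms that in auto)
    ultimately show ?thesis
      by linarith
  qed
  \<comment> \<open>The default value 0 of the integral makes this true without integrability.\<close>
  have nonneg: "0 \<le> integral S f" if "\<And>x. x \<in> S \<Longrightarrow> 0 \<le> f x" for S and f :: "real \<Rightarrow> real"
    using that by (cases "f integrable_on S") (auto intro: integral_nonneg simp: not_integrable_integral)
  have bound: "T \<le> root 3 (?c * L ^ 7 / (7 * J\<^sub>0 L u))"
    if "0 < T" "smooth_solution L T u" "0 < J\<^sub>0 L u" for T u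
  proof -
    have "0 \<le> integral {0..T} (\<lambda>t. integral {0..L} (\<lambda>x. (u (x, t))\<^sup>2 * \<phi> (t / T)))"
      using \<open>0 < T\<close> assms(5) by (intro nonneg mult_nonneg_nonneg) (auto simp: divide_le_eq_1)
    with estimate[OF that(1,2)] have "J\<^sub>0 L u \<le> ?c * L ^ 7 / (7 * T ^ 3)"
      by linarith
    then have "T ^ 3 \<le> ?c * L ^ 7 / (7 * J\<^sub>0 L u)"
      using that by (simp add: field_simps)
    then have "root 3 (T ^ 3) \<le> root 3 (?c * L ^ 7 / (7 * J\<^sub>0 L u))"
      by simp
    then show ?thesis
      using \<open>0 < T\<close> by (simp add: real_root_power_cancel)
  qed
  have lifespan: "\<exists>T\<^sub>0>0. T\<^sub>0 \<le> root 3 (?c * L ^ 7 / (7 * J\<^sub>0 L u)) \<and>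
      (\<forall>T. 0 < T \<and> T < T\<^sub>0 \<longrightarrow> smooth_solution L T u) \<and> (\<forall>T>T\<^sub>0. \<not> smooth_solution L T u)"
    if J: "0 < J\<^sub>0 L u" and S: "0 < S" "smooth_solution L S u" for S u
  proof -
    define X where "X = {T. 0 < T \<and> smooth_solution L T u}"
    have X: "S \<in> X" "\<And>T. T \<in> X \<Longrightarrow> T \<le> root 3 (?c * L ^ 7 / (7 * J\<^sub>0 L u))"
      using S bound[OF _ _ J] by (auto simp: X_def)
    have bdd: "bdd_above X"
      using X(2) by (rule bdd_aboveI)
    have "S \<le> Sup X"
      using X(1) bdd by (rule cSup_upper)
    moreover have "Sup X \<le> root 3 (?c * L ^ 7 / (7 * J\<^sub>0 L u))"
      using X by (intro cSup_least) auto
    moreover have "smooth_solution L T u" if less: "T < Sup X" for T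
    proof -
      obtain T' where "T' \<in> X" "T < T'"
        using less_cSupD[OF _ less] X(1) by (metis empty_iff)
      then show ?thesis
        using smooth_solution_mono[of L T' u T] by (simp add: X_def)
    qed
    moreover have "\<not> smooth_solution L T u" if "Sup X < T" for T
    proof
      assume "smooth_solution L T u"
      moreover have "0 < T"
        using that \<open>S \<le> Sup X\<close> \<open>0 < S\<close> by linarith
      ultimately have "T \<in> X"
        by (simp add: X_def)
      then have "T \<le> Sup X"
        using bdd by (rule cSup_upper)
      with that show False
        by simp
    qed
    ultimately show ?thesis
      using \<open>0 < S\<close> by (intro exI[of _ "Sup X"]) auto
  qed
  have nonexistence: "\<not> smooth_solution L T u"
    if "0 < J\<^sub>0 L u" "root 3 (?c * L ^ 7 / (7 * J\<^sub>0 L u)) < T" for T u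
  proof
    assume "smooth_solution L T u"
    moreover have "0 \<le> root 3 (?c * L ^ 7 / (7 * J\<^sub>0 L u))"
      using that(1) \<open>0 < L\<close> by simp
    ultimately show False
      using bound[of T u] that by linarith
  qed
  show ?thesis
    using estimate lifespan nonexistence by blast
qed

end
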